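(* Let $\Gamma$ be a simple strongly connected digraph with vertex set $X$ and diameter $D$. Then $\Gamma$ is a distance-regular digraph if and only if there exist numbers $b_{ij}$ $(0\le i,j\le D)$ such that $|\Gamma^{\rightarrow}_1(y)\cap\Gamma^{\rightarrow}_j(x)|=b_{ij}$ for all $x\in X$ and all $y\in\Gamma^{\rightarrow}_i(x)$ $(0\le i,j\le D)$.
   Context: $\partial(x,y)$ is the directed distance; $\Gamma^{\rightarrow}_i(x)=\{z\mid\partial(x,z)=i\}$; $\Gamma^{\rightarrow}_1(y)$, $\Gamma^{\leftarrow}_1(y)$ are the out- and in-neighbourhoods of $y$. $\Gamma$ is a distance-regular digraph if there are integers $d^{\rightarrow}_{ij},d^{\leftarrow}_{ij}$ $(0\le i,j\le D)$ such that for every $x\in X$ and every $y\in\Gamma^{\rightarrow}_i(x)$: $|\Gamma^{\rightarrow}_1(y)\cap\Gamma^{\rightarrow}_j(x)|=d^{\rightarrow}_{ij}$ and $|\Gamma^{\leftarrow}_1(y)\cap\Gamma^{\rightarrow}_j(x)|=d^{\leftarrow}_{ij}$. *)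

theory Defs
  imports "Graph_Theory.Graph_Theory"
begin

(* The AFP locale digraph describes finite digraphs without loops and without parallel arcs;
   two opposite arcs are allowed.  The vertex set X is verts G. *)

(* Shortest-path length for unit arc weights, hence the least number of arcs of a walk from
   x to y, and infinity if there is no such walk. *)
definition directed_dist :: "('a, 'b) pre_digraph \<Rightarrow> 'a \<Rightarrow> 'a \<Rightarrow> ereal" where
  "directed_dist G x y = wf_digraph.\<mu> G (\<lambda>_. 1) x y"

definition diameter :: "('a, 'b) pre_digraph \<Rightarrow> ereal" where
  "diameter G = (SUP (x, y) \<in> verts G \<times> verts G. directed_dist G x y)"

definition dist_layer :: "('a, 'b) pre_digraph \<Rightarrow> nat \<Rightarrow> 'a \<Rightarrow> 'a set" where
  "dist_layer G i x = {z \<in> verts G. directed_dist G x z = ereal (real i)}"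

(* In a digraph without loops, out_nbhd G y coincides with dist_layer G 1 y. *)
definition out_nbhd :: "('a, 'b) pre_digraph \<Rightarrow> 'a \<Rightarrow> 'a set" where
  "out_nbhd G y = {z \<in> verts G. y \<rightarrow>\<^bsub>G\<^esub> z}"

definition in_nbhd :: "('a, 'b) pre_digraph \<Rightarrow> 'a \<Rightarrow> 'a set" where
  "in_nbhd G y = {z \<in> verts G. z \<rightarrow>\<^bsub>G\<^esub> y}"

definition distance_regular :: "('a, 'b) pre_digraph \<Rightarrow> bool" where
  "distance_regular G \<longleftrightarrow>
    (\<exists>(d_out :: nat \<Rightarrow> nat \<Rightarrow> int) (d_in :: nat \<Rightarrow> nat \<Rightarrow> int).
       \<forall>i j. ereal (real i) \<le> diameter G \<longrightarrow> ereal (real j) \<le> diameter G \<longrightarrow>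
         (\<forall>x \<in> verts G. \<forall>y \<in> dist_layer G i x.
            int (card (out_nbhd G y \<inter> dist_layer G j x)) = d_out i j \<and>
            int (card (in_nbhd G y \<inter> dist_layer G j x)) = d_in i j))"

end

theory Submission
  imports Defs
begin

text \<open>
  Write \<open>A\<close> for the adjacency matrix, \<open>A\<^sup>T\<close> for its transpose, and call a matrix layered if its
  \<open>(x, y)\<close> entry depends only on the distance from \<open>x\<close> to \<open>y\<close>. The out-neighbourhood
  condition says that the space of layered matrices is closed under right multiplication by
  \<open>A\<^sup>T\<close>; for distance-regularity it must also be closed under right multiplication by \<open>A\<close>.
  By induction on \<open>n\<close>, whether \<open>y\<close> has distance at most \<open>n\<close> to \<open>x\<close> is determined by the distance
  from \<open>x\<close> to \<open>y\<close>; hence so is the distance from \<open>y\<close> to \<open>x\<close>, and the transpose \<open>A\<^sub>n\<^sup>T\<close> of every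
  distance matrix is layered. Since \<open>A\<^sub>n\<^sup>T A\<^sup>T\<close> is a linear combination of the \<open>A\<^sub>i\<^sup>T\<close> with
  \<open>i \<le> n + 1\<close> in which the last coefficient is nonzero, induction on \<open>n\<close> gives closure under right
  multiplication by every \<open>A\<^sub>n\<^sup>T\<close>. These span the layered matrices, one of which is \<open>A\<close>.
\<close>

section \<open>Layered matrices for an abstract finite hop distance\<close>

locale finite_hop_distance =
  fixes X :: "'a set" and E :: "'a \<Rightarrow> 'a \<Rightarrow> bool" and d :: "'a \<Rightarrow> 'a \<Rightarrow> nat" and D :: nat
  assumes finite_X: "finite X"
    and irrefl: "\<not> E x x"
    and d_eq_0: "x \<in> X \<Longrightarrow> y \<in> X \<Longrightarrow> d x y = 0 \<longleftrightarrow> x = y"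
    and d_le_step: "x \<in> X \<Longrightarrow> y \<in> X \<Longrightarrow> z \<in> X \<Longrightarrow> E y z \<Longrightarrow> d y x \<le> Suc (d z x)"
    and d_SucD: "x \<in> X \<Longrightarrow> y \<in> X \<Longrightarrow> d y x = Suc n \<Longrightarrow> \<exists>z\<in>X. E y z \<and> d z x = n"
    and d_le_D: "x \<in> X \<Longrightarrow> y \<in> X \<Longrightarrow> d x y \<le> D"
begin

text \<open>An arc bounds the distance by 1 and \<open>irrefl\<close> rules out 0; conversely, the
  first step of a path of length 1 lands at distance 0 from its end, so at the end itself.\<close>

lemma edge_iff: "x \<in> X \<Longrightarrow> y \<in> X \<Longrightarrow> E x y \<longleftrightarrow> d x y = 1"
  using d_eq_0 d_le_step[of y x y] d_SucD[of y x 0] irrefl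
  by (metis One_nat_def le_Suc_eq le_zero_eq)

definition layered :: "('a \<Rightarrow> 'a \<Rightarrow> real) \<Rightarrow> bool" where
  "layered M \<longleftrightarrow> (\<exists>m. \<forall>x\<in>X. \<forall>y\<in>X. M x y = m (d x y))"

definition mult :: "('a \<Rightarrow> 'a \<Rightarrow> real) \<Rightarrow> ('a \<Rightarrow> 'a \<Rightarrow> real) \<Rightarrow> 'a \<Rightarrow> 'a \<Rightarrow> real" where
  "mult M N x y = (\<Sum>z\<in>X. M x z * N z y)"

text \<open>Transposed, so that \<open>mult M adjT x y\<close> sums \<open>M x z\<close> over the
  out-neighbours \<open>z\<close> of \<open>y\<close>.\<close>

definition adjT :: "'a \<Rightarrow> 'a \<Rightarrow> real" where
  "adjT z y = of_bool (E y z)"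

definition distT :: "nat \<Rightarrow> 'a \<Rightarrow> 'a \<Rightarrow> real" where
  "distT n z y = of_bool (d y z = n)"

lemma layeredI: "(\<And>x y. x \<in> X \<Longrightarrow> y \<in> X \<Longrightarrow> M x y = m (d x y)) \<Longrightarrow> layered M"
  unfolding layered_def by blast

lemma layeredE:
  assumes "layered M"
  obtains m where "\<And>x y. x \<in> X \<Longrightarrow> y \<in> X \<Longrightarrow> M x y = m (d x y)"
  using assms unfolding layered_def by blast

lemma layered_cong:
  "(\<And>x y. x \<in> X \<Longrightarrow> y \<in> X \<Longrightarrow> M x y = N x y) \<Longrightarrow> layered M \<longleftrightarrow> layered N"
  unfolding layered_def by simp

text \<open>The operation \<open>h\<close> is arbitrary, so that tests for zero or positivity are
  covered as well as linear combinations.\<close>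

lemma layered_map2:
  assumes "layered M" "layered N"
  shows "layered (\<lambda>x y. h (M x y) (N x y))"
proof -
  obtain m where "\<And>x y. x \<in> X \<Longrightarrow> y \<in> X \<Longrightarrow> M x y = m (d x y)"
    using assms(1) by (rule layeredE) blast
  moreover obtain n where "\<And>x y. x \<in> X \<Longrightarrow> y \<in> X \<Longrightarrow> N x y = n (d x y)"
    using assms(2) by (rule layeredE) blast
  ultimately show ?thesis
    by (intro layeredI[of _ "\<lambda>i. h (m i) (n i)"]) simp
qed

lemma layered_scale: "layered M \<Longrightarrow> layered (\<lambda>x y. c * M x y)"
  using layered_map2[of M M "\<lambda>a _. c * a"] by simp

lemma layered_const: "layered (\<lambda>_ _. c)"
  by (rule layeredI) simp

lemma layered_sum:
  assumes "\<And>i. i \<in> I \<Longrightarrow> layered (M i)"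
  shows "layered (\<lambda>x y. \<Sum>i\<in>I. M i x y)"
  using assms
proof (induction I rule: infinite_finite_induct)
  case (insert i I)
  then show ?case
    using layered_map2[of "M i" "\<lambda>x y. \<Sum>i\<in>I. M i x y" "(+)"] by simp
qed (simp_all add: layered_const)

lemma mult_assoc: "mult (mult M N) P x y = mult M (mult N P) x y"
  unfolding mult_def sum_distrib_left sum_distrib_right
  by (subst sum.swap) (simp add: mult.assoc)

lemma mult_sum_scale:
  "mult M (\<lambda>z y. \<Sum>i\<in>I. c i * N i z y) x y = (\<Sum>i\<in>I. c i * mult M (N i) x y)"
  unfolding mult_def sum_distrib_left by (subst sum.swap) (simp add: mult.left_commute)

lemma mult_cong:
  "(\<And>z. z \<in> X \<Longrightarrow> N z y = P z y) \<Longrightarrow> mult M N x y = mult M P x y"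
  unfolding mult_def by simp

lemma layered_mult_lincomb:
  assumes "\<And>i. i \<in> I \<Longrightarrow> layered (mult M (N i))"
    and "\<And>x y. x \<in> X \<Longrightarrow> y \<in> X \<Longrightarrow> P x y = (\<Sum>i\<in>I. c i * N i x y)"
  shows "layered (mult M P)"
proof -
  have "layered (\<lambda>x y. \<Sum>i\<in>I. c i * mult M (N i) x y)"
    using assms(1) by (intro layered_sum layered_scale) auto
  moreover have "mult M P x y = (\<Sum>i\<in>I. c i * mult M (N i) x y)" if "x \<in> X" "y \<in> X" for x y
    using assms(2) that by (subst mult_sum_scale[symmetric], intro mult_cong) auto
  ultimately show ?thesis
    using layered_cong by (metis (no_types, lifting))
qed

text \<open>Groups the points \<open>z\<close> by their distance from \<open>x\<close>, which never
  exceeds \<open>D\<close>.\<close>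

lemma sum_layers:
  assumes "x \<in> X"
  shows "(\<Sum>z\<in>X. of_bool (P z) * g (d x z)) = (\<Sum>j\<le>D. g j * real (card {z\<in>X. P z \<and> d x z = j}))"
proof -
  have "real (card {z\<in>X. P z \<and> d x z = j}) = (\<Sum>z\<in>X. of_bool (P z) * of_bool (d x z = j))" for j
    using finite_X by (simp add: Int_def flip: of_bool_conj)
  then have "(\<Sum>j\<le>D. g j * real (card {z\<in>X. P z \<and> d x z = j}))
      = (\<Sum>j\<le>D. \<Sum>z\<in>X. of_bool (P z) * (g j * of_bool (d x z = j)))"
    by (simp add: sum_distrib_left mult.left_commute)
  also have "\<dots> = (\<Sum>z\<in>X. of_bool (P z) * (\<Sum>j\<le>D. g j * of_bool (d x z = j)))"
    by (subst sum.swap) (simp only: sum_distrib_left)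
  also have "\<dots> = (\<Sum>z\<in>X. of_bool (P z) * g (d x z))"
  proof (rule sum.cong)
    show "of_bool (P z) * (\<Sum>j\<le>D. g j * of_bool (d x z = j)) = of_bool (P z) * g (d x z)"
      if "z \<in> X" for z
      using d_le_D[OF assms that] by (simp add: of_bool_def if_distrib cong: if_cong)
  qed simp
  finally show ?thesis ..
qed

end

section \<open>Closure of layered matrices under multiplication, from out-regularity\<close>

locale out_regular_hop_distance = finite_hop_distance +
  fixes b :: "nat \<Rightarrow> nat \<Rightarrow> real"
  assumes out_regular: "x \<in> X \<Longrightarrow> y \<in> X \<Longrightarrow> j \<le> D \<Longrightarrow>
    real (card {z\<in>X. E y z \<and> d x z = j}) = b (d x y) j"
begin

lemma layered_mult_adjT:
  assumes "layered M"
  shows "layered (mult M adjT)"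
proof -
  obtain m where m: "\<And>x y. x \<in> X \<Longrightarrow> y \<in> X \<Longrightarrow> M x y = m (d x y)"
    using assms by (rule layeredE) blast
  show ?thesis
  proof (rule layeredI)
    fix x y assume xy: "x \<in> X" "y \<in> X"
    have "mult M adjT x y = (\<Sum>z\<in>X. of_bool (E y z) * m (d x z))"
      unfolding mult_def adjT_def using m xy by (simp add: mult.commute)
    also have "\<dots> = (\<Sum>j\<le>D. m j * real (card {z\<in>X. E y z \<and> d x z = j}))"
      by (rule sum_layers[OF xy(1)])
    also have "\<dots> = (\<Sum>j\<le>D. m j * b (d x y) j)"
      using out_regular xy by simp
    finally show "mult M adjT x y = (\<Sum>j\<le>D. m j * b (d x y) j)" .
  qed
qed

lemma mult_distT_adjT: "mult (distT n) adjT x y = real (card {z\<in>X. d z x = n \<and> E y z})"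
  unfolding mult_def distT_def adjT_def
  using finite_X by (simp add: Int_def flip: of_bool_conj)

lemma mult_distT_adjT_pos:
  assumes "z \<in> X" "E y z" "d z x = n"
  shows "mult (distT n) adjT x y > 0"
  unfolding mult_distT_adjT using assms finite_X by (auto simp: card_gt_0_iff)

text \<open>One arc lowers the distance to \<open>x\<close> by at most 1, so no out-neighbour of
  \<open>y\<close> can be at distance \<open>n\<close> to \<open>x\<close>.\<close>

lemma mult_distT_adjT_eq_0:
  assumes "x \<in> X" "y \<in> X" "Suc n < d y x"
  shows "mult (distT n) adjT x y = 0"
proof -
  have "{z\<in>X. d z x = n \<and> E y z} = {}"
    using assms d_le_step by fastforce
  then show ?thesis
    unfolding mult_distT_adjT by (simp only: card.empty of_nat_0)
qed

text \<open>The distance \<open>d y x\<close> is \<open>Suc n\<close> iff it is not at most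
  \<open>n\<close> and some out-neighbour of \<open>y\<close> has distance \<open>n\<close> to
  \<open>x\<close>. Both tests read entries of layered matrices, so the two claims are proved
  together.\<close>

lemma layered_distT_atMost: "layered (\<lambda>x y. of_bool (d y x \<le> n)) \<and> layered (distT n)"
proof (induction n)
  case 0
  show ?case
    by (intro conjI layeredI[of _ "\<lambda>i. of_bool (i = 0)"]) (auto simp: d_eq_0 distT_def)
next
  case (Suc n)
  have "distT (Suc n) x y
      = of_bool (of_bool (d y x \<le> n) = (0::real) \<and> mult (distT n) adjT x y > 0)"
    if xy: "x \<in> X" "y \<in> X" for x y
  proof (cases "d y x = Suc n")
    case True
    then show ?thesis
      using d_SucD[OF xy True] mult_distT_adjT_pos by (auto simp: distT_def)
  next
    case False
    then show ?thesis
      using mult_distT_adjT_eq_0[OF xy, of n] by (cases "d y x \<le> n") (auto simp: distT_def)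
  qed
  then have *: "layered (distT (Suc n))"
    using layered_map2[OF conjunct1[OF Suc] layered_mult_adjT[OF conjunct2[OF Suc]],
        of "\<lambda>a b. of_bool (a = 0 \<and> b > 0)"]
      layered_cong by (metis (no_types, lifting))
  have "layered (\<lambda>x y. of_bool (d y x \<le> n) + distT (Suc n) x y)"
    using layered_map2[OF conjunct1[OF Suc] *, of "(+)"] .
  moreover have "of_bool (d y x \<le> n) + distT (Suc n) x y = of_bool (d y x \<le> Suc n)" for x y
    by (auto simp: distT_def)
  ultimately show ?case
    using * by simp
qed

lemma reverse_distance:
  assumes "x \<in> X" "y \<in> X" "x' \<in> X" "y' \<in> X" "d x y = d x' y'"
  shows "d y x = d y' x'"
proof -
  \<comment> \<open>The index \<open>d y' x'\<close> is chosen to make the entry at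
    \<open>(x', y')\<close> equal to 1.\<close>
  obtain m where "\<And>x y. x \<in> X \<Longrightarrow> y \<in> X \<Longrightarrow> distT (d y' x') x y = m (d x y)"
    using layeredE[OF conjunct2[OF layered_distT_atMost[of "d y' x'"]]] by metis
  then have "distT (d y' x') x y = distT (d y' x') x' y'"
    using assms by simp
  then show ?thesis
    by (simp add: distT_def split: if_splits)
qed

text \<open>By \<open>reverse_distance\<close>, equal values of \<open>d y x\<close> force equal
  values of \<open>d x y\<close>. This form is needed to expand \<open>N\<close> in the matrices
  \<open>distT i\<close>.\<close>

lemma layered_reverseE:
  assumes "layered N"
  obtains c where "\<And>x y. x \<in> X \<Longrightarrow> y \<in> X \<Longrightarrow> N x y = c (d y x)"
proof -
  \<comment> \<open>The common value is unique if distance \<open>i\<close> occurs, and unspecified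
    otherwise.\<close>
  define c where "c i = (THE r. \<forall>x\<in>X. \<forall>y\<in>X. d y x = i \<longrightarrow> N x y = r)" for i
  have "N x y = c (d y x)" if "x \<in> X" "y \<in> X" for x y
    unfolding c_def
  proof (rule the_equality[symmetric])
    obtain m where "\<And>x y. x \<in> X \<Longrightarrow> y \<in> X \<Longrightarrow> N x y = m (d x y)"
      using assms by (rule layeredE) blast
    then show "\<forall>x'\<in>X. \<forall>y'\<in>X. d y' x' = d y x \<longrightarrow> N x' y' = N x y"
      using reverse_distance that by metis
  qed (use that in blast)
  then show thesis
    using that by blast
qed

text \<open>Strong induction: \<open>distT n\<close> is expressed by
  \<open>mult (distT k) adjT\<close>, where \<open>n = Suc k\<close>, and by all
  \<open>distT i\<close> with \<open>i < n\<close>.\<close>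

lemma layered_mult_distT:
  assumes "layered M"
  shows "layered (mult M (distT n))"
proof (induction n rule: less_induct)
  case (less n)
  show ?case
  proof (cases n)
    case 0
    have "mult M (distT n) x y = M x y" if "x \<in> X" "y \<in> X" for x y
    proof -
      have "mult M (distT n) x y = (\<Sum>z\<in>X. if z = y then M x z else 0)"
        unfolding mult_def distT_def 0 using that by (intro sum.cong) (auto simp: d_eq_0)
      then show ?thesis
        using finite_X that by simp
    qed
    then show ?thesis
      using assms layered_cong by (metis (no_types, lifting))
  next
    case (Suc k)
    show ?thesis
    proof (cases "\<exists>x\<in>X. \<exists>y\<in>X. d y x = n")
      \<comment> \<open>If distance \<open>n\<close> does not occur, \<open>distT n\<close> vanishes
        on \<open>X\<close>; this case is split off because \<open>c n\<close> below could then be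
        0.\<close>
      case False
      then have "mult M (distT n) x y = 0" if "x \<in> X" "y \<in> X" for x y
        unfolding mult_def distT_def using that by (intro sum.neutral) auto
      then show ?thesis
        using layered_const[of 0] layered_cong by (metis (no_types, lifting))
    next
      case True
      obtain c where c: "\<And>x y. x \<in> X \<Longrightarrow> y \<in> X \<Longrightarrow> mult (distT k) adjT x y = c (d y x)"
        using layered_reverseE layered_mult_adjT layered_distT_atMost by metis
      \<comment> \<open>A pair at distance \<open>n\<close> has a first step to distance
        \<open>k\<close>, which makes its entry positive.\<close>
      have "c n \<noteq> 0"
        using True c d_SucD mult_distT_adjT_pos Suc by (metis less_irrefl)
      \<comment> \<open>The expansion of \<open>mult (distT k) adjT\<close> with coefficients
        \<open>c i\<close> is solved for \<open>distT n\<close>; the product takes the place of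
        index \<open>n\<close> in the family.\<close>
      define N where "N i = (if i = n then mult (distT k) adjT else distT i)" for i
      have "layered (mult M (N i))" if "i \<in> {..n}" for i
      proof (cases "i = n")
        case True
        \<comment> \<open>Reassociating lets the induction hypothesis treat
          \<open>mult M (distT k)\<close> before the factor \<open>adjT\<close> is applied.\<close>
        have "layered (mult (mult M (distT k)) adjT)"
          using less.IH[of k] Suc by (intro layered_mult_adjT) simp
        then show ?thesis
          using layered_cong[OF mult_assoc] True by (simp add: N_def)
      next
        case False
        then show ?thesis
          using less.IH[of i] that by (simp add: N_def)
      qed
      moreover have "distT n x y = (\<Sum>i\<le>n. (if i = n then 1 / c n else - c i / c n) * N i x y)"
        if xy: "x \<in> X" "y \<in> X" for x y
      proof -
        have "(\<Sum>i<n. c i * distT i x y) = (if d y x < n then c (d y x) else 0)"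
          by (simp add: distT_def of_bool_def if_distrib cong: if_cong)
        moreover have "c (d y x) = 0" if "d y x > n"
          using mult_distT_adjT_eq_0[OF xy, of k] c xy that Suc by simp
        ultimately have "c n * distT n x y = c (d y x) - (\<Sum>i<n. c i * distT i x y)"
          by (cases "d y x" n rule: linorder_cases) (auto simp: distT_def)
        then have "distT n x y = c (d y x) / c n - (\<Sum>i<n. c i * distT i x y) / c n"
          using \<open>c n \<noteq> 0\<close> by (simp add: field_simps)
        also have "\<dots> = (\<Sum>i\<le>n. (if i = n then 1 / c n else - c i / c n) * N i x y)"
          using c xy
          by (simp add: N_def sum_divide_distrib sum_negf flip: lessThan_Suc_atMost)
        finally show ?thesis .
      qed
      ultimately show ?thesis
        by (rule layered_mult_lincomb)
    qed
  qed
qed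

text \<open>On \<open>X\<close>, every layered \<open>N\<close> is a linear combination of the
  \<open>distT i\<close> with \<open>i \<le> D\<close>.\<close>

lemma layered_mult:
  assumes "layered M" "layered N"
  shows "layered (mult M N)"
proof -
  obtain c where c: "\<And>x y. x \<in> X \<Longrightarrow> y \<in> X \<Longrightarrow> N x y = c (d y x)"
    using assms(2) by (rule layered_reverseE) blast
  have "N x y = (\<Sum>i\<le>D. c i * distT i x y)" if "x \<in> X" "y \<in> X" for x y
    using c[OF that] d_le_D[of y x] that
    by (simp add: distT_def of_bool_def if_distrib cong: if_cong)
  then show ?thesis
    using layered_mult_distT[OF assms(1)] by (rule layered_mult_lincomb[rotated])
qed

text \<open>The count is an entry of the product of the distance-\<open>j\<close> matrix and the
  adjacency matrix, both layered.\<close>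

theorem in_regular: "\<exists>m. \<forall>x\<in>X. \<forall>y\<in>X. card {z\<in>X. d x z = j \<and> E z y} = m (d x y)"
proof -
  have "layered (mult (\<lambda>x z. of_bool (d x z = j)) (\<lambda>z y. of_bool (E z y)))"
    by (rule layered_mult;
        rule layeredI[of _ "\<lambda>i. of_bool (i = j)"] layeredI[of _ "\<lambda>i. of_bool (i = 1)"];
        simp add: edge_iff)
  moreover have "mult (\<lambda>x z. of_bool (d x z = j)) (\<lambda>z y. of_bool (E z y)) x y
      = real (card {z\<in>X. d x z = j \<and> E z y})" for x y
    unfolding mult_def using finite_X by (simp add: Int_def flip: of_bool_conj)
  ultimately obtain m where
    m: "\<And>x y. x \<in> X \<Longrightarrow> y \<in> X \<Longrightarrow> real (card {z\<in>X. d x z = j \<and> E z y}) = m (d x y)"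
    by (auto elim: layeredE)
  \<comment> \<open>The real function \<open>m\<close> is a count only at distances that occur; the
    floor turns it into a natural-valued function.\<close>
  have "card {z\<in>X. d x z = j \<and> E z y} = nat \<lfloor>m (d x y)\<rfloor>" if "x \<in> X" "y \<in> X" for x y
    unfolding m[OF that, symmetric] by simp
  then show ?thesis
    by (intro exI[of _ "\<lambda>i. nat \<lfloor>m i\<rfloor>"]) blast
qed

end

section \<open>Directed distance in a digraph as a hop distance\<close>

text \<open>Unreachable pairs get the junk value \<open>0\<close>.\<close>

definition hops :: "('a, 'b) pre_digraph \<Rightarrow> 'a \<Rightarrow> 'a \<Rightarrow> nat" where
  "hops G x y = nat \<lfloor>real_of_ereal (directed_dist G x y)\<rfloor>"

lemma (in wf_digraph) awalk_cost_1: "awalk_cost (\<lambda>_. 1) p = real (length p)"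
  by (induction p) auto

context digraph
begin

lemma shortest_awalk:
  assumes "x \<rightarrow>\<^sup>* y"
  obtains p where "awalk x p y" "hops G x y = length p" "directed_dist G x y = ereal (hops G x y)"
proof -
  obtain p where p: "apath x p y" "\<mu> (\<lambda>_. 1) x y = awalk_cost (\<lambda>_. 1) p"
    using min_cost_awalk[OF assms, of "\<lambda>_. 1"] by auto
  then have "directed_dist G x y = ereal (length p)"
    by (simp add: directed_dist_def awalk_cost_1)
  then show thesis
    using that[of p] p(1) by (simp add: hops_def awalkI_apath)
qed

lemma hops_le_length:
  assumes "awalk x p y"
  shows "hops G x y \<le> length p"
proof -
  have "directed_dist G x y \<le> ereal (length p)"
    using min_cost_le_walk_cost[OF assms, of "\<lambda>_. 1"] by (simp add: directed_dist_def awalk_cost_1)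
  moreover have "directed_dist G x y = ereal (hops G x y)"
    using assms shortest_awalk reachable_awalk by metis
  ultimately show ?thesis
    by simp
qed

text \<open>Strong connectivity provides shortest walks. Prepending an arc to one gives the step
  bound, and deleting its first arc gives the predecessor property.\<close>

lemma finite_hop_distance_hops:
  assumes sc: "strongly_connected G" and diam: "diameter G = ereal (real D)"
  shows "finite_hop_distance (verts G) (dominates G) (hops G) D"
proof
  have reach: "x \<rightarrow>\<^sup>* y" if "x \<in> verts G" "y \<in> verts G" for x y
    using sc that by (auto simp: strongly_connected_def)
  show "finite (verts G)" by simp
  show "\<not> x \<rightarrow> x" for x
    using adj_not_same by blast
  fix x y assume xy: "x \<in> verts G" "y \<in> verts G"
  show "hops G x y = 0 \<longleftrightarrow> x = y"
  proof
    show "x = y" if "hops G x y = 0"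
      using shortest_awalk[OF reach[OF xy]] that awalk_empty_ends by (metis length_0_conv)
    show "hops G x y = 0" if "x = y"
      using hops_le_length[of x "[]" y] that xy by (simp add: awalk_Nil_iff)
  qed
  show "hops G y x \<le> Suc (hops G z x)" if z: "z \<in> verts G" "y \<rightarrow> z" for z
  proof -
    obtain p where p: "awalk z p x" "hops G z x = length p"
      using shortest_awalk[OF reach[OF z(1) xy(1)]] by metis
    obtain e where "e \<in> arcs G" "arc_to_ends G e = (y, z)"
      using z(2) by (auto simp: arcs_ends_def)
    then show ?thesis
      using hops_le_length[of y "e # p" x] awalk_ConsI p by auto
  qed
  note step = this
  show "\<exists>z\<in>verts G. y \<rightarrow> z \<and> hops G z x = n" if n: "hops G y x = Suc n" for n
  proof -
    obtain p where p: "awalk y p x" "length p = Suc n"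
      using shortest_awalk[OF reach[OF xy(2,1)]] n by metis
    then obtain e es where es: "p = e # es"
      by (cases p) auto
    then have e: "e \<in> arcs G" "y = tail G e" "awalk (head G e) es x"
      using p by (auto simp: awalk_Cons_iff)
    then have dom: "y \<rightarrow> head G e" "head G e \<in> verts G"
      using in_arcs_imp_in_arcs_ends by auto
    \<comment> \<open>The remaining walk gives the upper bound, the step bound the lower
      one.\<close>
    have "hops G (head G e) x = n"
      using hops_le_length[OF e(3)] step[OF dom(2,1)] n p(2) es by simp
    then show ?thesis
      using dom by blast
  qed
  have "directed_dist G x y \<le> diameter G"
    unfolding diameter_def using xy by (intro SUP_upper2[of "(x, y)"]) auto
  then show "hops G x y \<le> D"
    using shortest_awalk[OF reach[OF xy]] diam by (metis ereal_less_eq(3) of_nat_le_iff)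
qed

lemma dist_layer_hops:
  assumes "strongly_connected G" "x \<in> verts G"
  shows "dist_layer G i x = {z \<in> verts G. hops G x z = i}"
proof -
  have "directed_dist G x z = ereal (hops G x z)" if "z \<in> verts G" for z
    using assms that shortest_awalk by (metis strongly_connected_def)
  then show ?thesis
    unfolding dist_layer_def by auto
qed

end

section \<open>Transfer of regularity to the digraph\<close>

theorem theorem10p2:
  fixes G :: "('a, 'b) pre_digraph" and D :: nat
  assumes "digraph G"
    and "strongly_connected G"
    and "diameter G = ereal (real D)"
  shows "distance_regular G \<longleftrightarrow>
    (\<exists>b :: nat \<Rightarrow> nat \<Rightarrow> real.
       \<forall>i \<le> D. \<forall>j \<le> D. \<forall>x \<in> verts G. \<forall>y \<in> dist_layer G i x.
         real (card (out_nbhd G y \<inter> dist_layer G j x)) = b i j)"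
    (is "_ \<longleftrightarrow> ?out_regular")
proof
  assume "distance_regular G"
  then obtain d_out d_in :: "nat \<Rightarrow> nat \<Rightarrow> int" where
    "\<And>i j x y. i \<le> D \<Longrightarrow> j \<le> D \<Longrightarrow> x \<in> verts G \<Longrightarrow> y \<in> dist_layer G i x \<Longrightarrow>
       int (card (out_nbhd G y \<inter> dist_layer G j x)) = d_out i j \<and>
       int (card (in_nbhd G y \<inter> dist_layer G j x)) = d_in i j"
    unfolding distance_regular_def assms(3) ereal_less_eq of_nat_le_iff by metis
  then show ?out_regular
    by (intro exI[of _ "\<lambda>i j. real_of_int (d_out i j)"]) (metis of_int_of_nat_eq)
next
  assume ?out_regular
  then obtain b :: "nat \<Rightarrow> nat \<Rightarrow> real" where
    b: "\<And>i j x y. i \<le> D \<Longrightarrow> j \<le> D \<Longrightarrow> x \<in> verts G \<Longrightarrow> y \<in> dist_layer G i x \<Longrightarrow>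
          real (card (out_nbhd G y \<inter> dist_layer G j x)) = b i j"
    by blast
  interpret digraph G by fact
  interpret finite_hop_distance "verts G" "dominates G" "hops G" D
    using assms(2,3) by (rule finite_hop_distance_hops)
  note layer = dist_layer_hops[OF assms(2)]
  have out: "out_nbhd G y \<inter> dist_layer G j x = {z \<in> verts G. y \<rightarrow>\<^bsub>G\<^esub> z \<and> hops G x z = j}"
    and in_nbhd: "in_nbhd G y \<inter> dist_layer G j x = {z \<in> verts G. hops G x z = j \<and> z \<rightarrow>\<^bsub>G\<^esub> y}"
    if "x \<in> verts G" for x y j
    using layer[OF that] by (auto simp: out_nbhd_def in_nbhd_def)
  interpret out_regular_hop_distance "verts G" "dominates G" "hops G" D b
  proof
    fix x y j assume "x \<in> verts G" "y \<in> verts G" "j \<le> D"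
    then show "real (card {z \<in> verts G. y \<rightarrow>\<^bsub>G\<^esub> z \<and> hops G x z = j}) = b (hops G x y) j"
      using b[of "hops G x y" j x y] d_le_D by (simp add: layer flip: out)
  qed
  have "\<forall>j. \<exists>m. \<forall>x\<in>verts G. \<forall>y\<in>verts G.
      card {z \<in> verts G. hops G x z = j \<and> z \<rightarrow>\<^bsub>G\<^esub> y} = m (hops G x y)"
    by (rule allI, rule in_regular)
  from choice[OF this] obtain m where m: "\<And>j x y. x \<in> verts G \<Longrightarrow> y \<in> verts G \<Longrightarrow>
      card {z \<in> verts G. hops G x z = j \<and> z \<rightarrow>\<^bsub>G\<^esub> y} = m j (hops G x y)"
    by blast
  \<comment> \<open>On occurring distances \<open>b i j\<close> is a cardinality, so its floor
    supplies the required integer.\<close>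
  have "int (card (out_nbhd G y \<inter> dist_layer G j x)) = \<lfloor>b i j\<rfloor> \<and>
      int (card (in_nbhd G y \<inter> dist_layer G j x)) = int (m j i)"
    if "i \<le> D" "j \<le> D" "x \<in> verts G" "y \<in> dist_layer G i x" for i j x y
  proof
    show "int (card (out_nbhd G y \<inter> dist_layer G j x)) = \<lfloor>b i j\<rfloor>"
      unfolding b[OF that, symmetric] by simp
    have "y \<in> verts G" "hops G x y = i"
      using that layer by auto
    then show "int (card (in_nbhd G y \<inter> dist_layer G j x)) = int (m j i)"
      using m[of x y j] that in_nbhd by simp
  qed
  then show "distance_regular G"
    unfolding distance_regular_def assms(3)
    by (intro exI[of _ "\<lambda>i j. \<lfloor>b i j\<rfloor>"] exI[of _ "\<lambda>i j. int (m j i)"]) simp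
qed

end
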